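(* Let $m,n_1,n_2$ be positive integers with $n_1\ge m-2>n_2$ and $2\nmid mn_1$. If $$n_1>m-5+n_2+\frac{(n_2-1)^2}{m-2-n_2},$$ then $r(K_{1,m-1},S(n_1,n_2))=m-1+n_1$.
   Context: All graphs are finite simple graphs. For graphs $G_1,G_2$, the Ramsey number $r(G_1,G_2)$ is the smallest positive integer $N$ such that for every graph $G$ on $N$ vertices, either $G$ contains a (not necessarily induced) subgraph isomorphic to $G_1$, or the complement $\overline{G}$ contains a subgraph isomorphic to $G_2$. $K_{1,m-1}$ is the star on $m$ vertices. For positive integers $n_1\ge n_2$, the double star $S(n_1,n_2)$ is the tree with vertex set $\{v_0,v_1,\ldots,v_{n_1},w_0,w_1,\ldots,w_{n_2}\}$ and edge set $\{v_0v_1,\ldots,v_0v_{n_1},v_0w_0,w_0w_1,\ldots,w_0w_{n_2}\}$. *)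

theory Defs
  imports Complex_Main "Graph_Theory.Graph_Theory"
begin

text \<open>
  A finite simple graph is a \<^locale>\<open>pair_graph\<close>: each edge is represented by its two
  opposite arcs.
\<close>

definition graph_complement :: "'a pair_pre_digraph \<Rightarrow> 'a pair_pre_digraph" where
  "graph_complement G = \<lparr> pverts = pverts G,
     parcs = {(u, v). u \<in> pverts G \<and> v \<in> pverts G \<and> u \<noteq> v \<and> (u, v) \<notin> parcs G} \<rparr>"

lemma pair_graph_complement:
  assumes "pair_graph G" shows "pair_graph (graph_complement G)"
proof -
  interpret pair_graph G by fact
  have "parcs (graph_complement G) \<subseteq> pverts G \<times> pverts G"
    by (auto simp: graph_complement_def)
  then have "finite (parcs (graph_complement G))"
    using pair_finite_verts by (meson finite_SigmaI finite_subset)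
  then show ?thesis
    using pair_finite_verts
    by unfold_locales
       (auto simp: graph_complement_def symmetric_def intro!: symI dest: arcs_symmetric)
qed

definition contains_copy :: "'a pair_pre_digraph \<Rightarrow> 'b pair_pre_digraph \<Rightarrow> bool" where
  "contains_copy G F \<longleftrightarrow>
     (\<exists>H :: 'a pair_pre_digraph. subgraph (with_proj H) (with_proj G) \<and>
        digraph_iso (with_proj H) (with_proj F))"

lemma contains_copy_iff:
  assumes "pair_graph G" "pair_graph F"
  shows "contains_copy G F \<longleftrightarrow>
    (\<exists>f. inj_on f (pverts F) \<and> f ` pverts F \<subseteq> pverts G \<and>
       (\<forall>(u, v) \<in> parcs F. (f u, f v) \<in> parcs G))"
proof
  interpret G: pair_graph G by fact
  interpret F: pair_graph F by fact
  assume "contains_copy G F"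
  then obtain H where sub: "subgraph (with_proj H) (with_proj G)"
    and iso: "digraph_iso (with_proj H) (with_proj F)"
    by (auto simp: contains_copy_def)
  have "digraph_iso (with_proj F) (with_proj H)"
    using iso sub by (auto intro: digraph_iso_swap simp: subgraph_def)
  then obtain h where h: "pre_digraph.digraph_isomorphism (with_proj F) h"
    and H: "with_proj H = app_iso h (with_proj F)"
    by (auto simp: digraph_iso_def)
  have V: "pverts H = iso_verts h ` pverts F" and A: "parcs H = iso_arcs h ` parcs F"
    using arg_cong[OF H, of verts] arg_cong[OF H, of arcs] by simp_all
  have t: "iso_tail h = fst" and hd: "iso_head h = snd"
    using arg_cong[OF H, of tail] arg_cong[OF H, of head] by simp_all
  have "(iso_verts h u, iso_verts h v) \<in> parcs G" if uv: "(u, v) \<in> parcs F" for u v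
  proof -
    have "iso_verts h u = fst (iso_arcs h (u, v))" "iso_verts h v = snd (iso_arcs h (u, v))"
      using h uv t hd by (force simp: pre_digraph.digraph_isomorphism_def)+
    then have "(iso_verts h u, iso_verts h v) = iso_arcs h (u, v)" by simp
    then show ?thesis using A sub uv by (auto simp: subgraph_def)
  qed
  moreover have "inj_on (iso_verts h) (pverts F)"
    using h by (simp add: pre_digraph.digraph_isomorphism_def)
  ultimately show "\<exists>f. inj_on f (pverts F) \<and> f ` pverts F \<subseteq> pverts G \<and>
       (\<forall>(u, v) \<in> parcs F. (f u, f v) \<in> parcs G)"
    using V sub by (intro exI[of _ "iso_verts h"]) (auto simp: subgraph_def)
next
  interpret G: pair_graph G by fact
  interpret F: pair_graph F by fact
  assume "\<exists>f. inj_on f (pverts F) \<and> f ` pverts F \<subseteq> pverts G \<and>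
       (\<forall>(u, v) \<in> parcs F. (f u, f v) \<in> parcs G)"
  then obtain f where f: "inj_on f (pverts F)" "f ` pverts F \<subseteq> pverts G"
    "\<And>u v. (u, v) \<in> parcs F \<Longrightarrow> (f u, f v) \<in> parcs G"
    by fast
  define H where "H = \<lparr> pverts = f ` pverts F, parcs = map_prod f f ` parcs F \<rparr>"
  define h where
    "h = \<lparr> iso_verts = f, iso_arcs = map_prod f f, iso_head = snd, iso_tail = fst \<rparr>"
  have "inj_on (map_prod f f) (parcs F)"
    by (rule inj_on_subset[OF map_prod_inj_on[OF f(1) f(1)]]) (auto dest: F.in_arcsD1 F.in_arcsD2)
  then have "pre_digraph.digraph_isomorphism (with_proj F) h"
    using f(1) F.wf_digraph by (auto simp: pre_digraph.digraph_isomorphism_def h_def)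
  moreover have "with_proj H = app_iso h (with_proj F)"
    by (simp add: H_def h_def app_iso_def with_proj_def)
  ultimately have "digraph_iso (with_proj F) (with_proj H)"
    by (auto simp: digraph_iso_def)
  then have "digraph_iso (with_proj H) (with_proj F)"
    using F.wf_digraph by (rule digraph_iso_swap[rotated])
  moreover have "pair_wf_digraph H"
    by unfold_locales (auto simp: H_def dest: F.in_arcsD1 F.in_arcsD2)
  then have "subgraph (with_proj H) (with_proj G)"
    using f G.wf_digraph by (auto simp: subgraph_def compatible_def wf_digraph_wp_iff H_def)
  ultimately show "contains_copy G F" by (auto simp: contains_copy_def)
qed

text \<open>
  Every graph on \<open>N\<close> vertices is isomorphic to one whose vertices are natural numbers, so
  it suffices to quantify over those.
\<close>

definition ramsey_number :: "'a pair_pre_digraph \<Rightarrow> 'b pair_pre_digraph \<Rightarrow> nat" where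
  "ramsey_number G1 G2 =
     (LEAST N. N > 0 \<and>
        (\<forall>G :: nat pair_pre_digraph. pair_graph G \<and> card (pverts G) = N \<longrightarrow>
           contains_copy G G1 \<or> contains_copy (graph_complement G) G2))"

definition simple_graph :: "'a set \<Rightarrow> ('a \<times> 'a) set \<Rightarrow> 'a pair_pre_digraph" where
  "simple_graph V E = \<lparr> pverts = V, parcs = E \<union> E\<inverse> \<rparr>"

lemma pair_graph_simple_graph:
  assumes "finite V" "E \<subseteq> V \<times> V" "\<And>v. (v, v) \<notin> E"
  shows "pair_graph (simple_graph V E)"
proof -
  have "finite E" using assms(1,2) by (meson finite_SigmaI finite_subset)
  with assms show ?thesis
    by unfold_locales (auto simp: simple_graph_def symmetric_def intro!: symI)
qed

definition star :: "nat \<Rightarrow> nat pair_pre_digraph" where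
  "star k = simple_graph {0..k} {(0, i) |i. i \<in> {1..k}}"

lemma pair_graph_star: "pair_graph (star k)"
  unfolding star_def by (rule pair_graph_simple_graph) auto

lemma star_complete_bipartite: "K\<^bsub>1,k\<^esub> (with_proj (star k))"
  unfolding complete_bipartite_digraph_pair_def
proof (intro conjI exI)
  show "pverts (star k) = {0} \<union> {1..k}"
    and "parcs (star k) = {0} \<times> {1..k} \<union> {1..k} \<times> {0}"
    by (auto simp: star_def simple_graph_def)
qed (auto simp: star_def simple_graph_def)

datatype double_star_vertex = V nat | W nat

definition double_star :: "nat \<Rightarrow> nat \<Rightarrow> double_star_vertex pair_pre_digraph" where
  "double_star n\<^sub>1 n\<^sub>2 = simple_graph
     (V ` {0..n\<^sub>1} \<union> W ` {0..n\<^sub>2})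
     ({(V 0, V i) |i. i \<in> {1..n\<^sub>1}} \<union> {(V 0, W 0)} \<union> {(W 0, W j) |j. j \<in> {1..n\<^sub>2}})"

lemma pair_graph_double_star: "pair_graph (double_star n\<^sub>1 n\<^sub>2)"
  unfolding double_star_def by (rule pair_graph_simple_graph) auto

end

theory Submission
  imports Defs
begin

text \<open>
  Lower bound: since \<open>m - 3\<close> is even, there is an \<open>(m - 3)\<close>-regular circulant graph on
  \<open>m - 2 + n\<^sub>1\<close> vertices. Its complement is \<open>n\<^sub>1\<close>-regular, while the double star needs a vertex
  of degree \<open>n\<^sub>1 + 1\<close>; both degree bounds survive the deletion of vertices.

  Upper bound: let \<open>G\<close> have \<open>m - 1 + n\<^sub>1\<close> vertices and maximum degree at most \<open>m - 2\<close>, so that its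
  complement \<open>H\<close> has minimum degree at least \<open>n\<^sub>1\<close>. As \<open>m\<close> and \<open>n\<^sub>1\<close> are odd, \<open>G\<close> is not
  \<open>(m - 2)\<close>-regular, so some \<open>v\<close> has degree \<open>n\<^sub>1 + e\<close> in \<open>H\<close> with \<open>e \<ge> 1\<close>. If no neighbour \<open>w\<close>
  of \<open>v\<close> completes a double star, each one has at most \<open>n\<^sub>2 - e\<close> neighbours in the set \<open>A\<close> of
  \<open>m - 2 - e\<close> non-neighbours of \<open>v\<close>. Each vertex of \<open>A\<close> has at least \<open>n\<^sub>1 - (m - 3 - e)\<close>
  neighbours outside \<open>A\<close>, and counting the edges between \<open>A\<close> and the neighbourhood of \<open>v\<close> twice
  contradicts the hypothesis on \<open>n\<^sub>1\<close>.
\<close>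

section \<open>Neighbourhoods and degrees in a graph and its complement\<close>

definition nbs :: "'a pair_pre_digraph \<Rightarrow> 'a \<Rightarrow> 'a set" where
  "nbs G v = {u. (v, u) \<in> parcs G}"

lemma nbs_subset:
  assumes "pair_graph G" shows "nbs G v \<subseteq> pverts G - {v}"
proof -
  interpret pair_graph G by fact
  show ?thesis
    using in_arcsD2 no_loops by (fastforce simp: nbs_def)
qed

lemma finite_pverts:
  assumes "pair_graph G" shows "finite (pverts G)"
proof -
  interpret pair_graph G by fact
  show ?thesis by (rule pair_finite_verts)
qed

lemma finite_nbs: "pair_graph G \<Longrightarrow> finite (nbs G v)"
  by (meson finite_Diff finite_pverts finite_subset nbs_subset)

lemma nbs_sym:
  assumes "pair_graph G" shows "u \<in> nbs G v \<longleftrightarrow> v \<in> nbs G u"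
proof -
  interpret pair_graph G by fact
  show ?thesis using arcs_symmetric by (auto simp: nbs_def)
qed

lemma nbs_in_pverts: "pair_graph G \<Longrightarrow> u \<in> nbs G v \<Longrightarrow> v \<in> pverts G"
  using nbs_sym[of G u v] nbs_subset[of G u] by blast

lemma pverts_complement [simp]: "pverts (graph_complement G) = pverts G"
  by (simp add: graph_complement_def)

lemma nbs_complement:
  "v \<in> pverts G \<Longrightarrow> nbs (graph_complement G) v = pverts G - {v} - nbs G v"
  by (auto simp: nbs_def graph_complement_def)

lemma card_nbs_complement:
  assumes "pair_graph G" "v \<in> pverts G"
  shows "card (nbs G v) + card (nbs (graph_complement G) v) + 1 = card (pverts G)"
proof -
  have "card (pverts G - {v} - nbs G v) = card (pverts G - {v}) - card (nbs G v)"
    using assms by (intro card_Diff_subset finite_nbs nbs_subset)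
  moreover have "card (nbs G v) \<le> card (pverts G - {v})"
    using assms by (intro card_mono nbs_subset finite_Diff finite_pverts)
  moreover have "card (pverts G) = card (pverts G - {v}) + 1"
    using assms finite_pverts[OF assms(1)] by (metis Suc_eq_plus1 card_Suc_Diff1)
  ultimately show ?thesis
    unfolding nbs_complement[OF assms(2)] by linarith
qed

section \<open>Copies of stars and double stars from degree conditions\<close>

lemma contains_star_iff:
  assumes "pair_graph G"
  shows "contains_copy G (star k) \<longleftrightarrow> (\<exists>v\<in>pverts G. k \<le> card (nbs G v))"
proof
  assume "contains_copy G (star k)"
  then obtain f where f: "inj_on f {0..k}" "f ` {0..k} \<subseteq> pverts G"
    "\<forall>(u, v) \<in> parcs (star k). (f u, f v) \<in> parcs G"
    unfolding contains_copy_iff[OF assms pair_graph_star]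
    by (auto simp: star_def simple_graph_def)
  have "f ` {1..k} \<subseteq> nbs G (f 0)"
    using f(3) by (auto simp: nbs_def star_def simple_graph_def)
  moreover have "card (f ` {1..k}) = k"
    using f(1) by (subst card_image) (auto intro: inj_on_subset)
  ultimately have "k \<le> card (nbs G (f 0))"
    by (metis assms card_mono finite_nbs)
  then show "\<exists>v\<in>pverts G. k \<le> card (nbs G v)"
    using f(2) by (intro bexI[of _ "f 0"]) auto
next
  assume "\<exists>v\<in>pverts G. k \<le> card (nbs G v)"
  then obtain v B where v: "v \<in> pverts G" and B: "B \<subseteq> nbs G v" "card B = k"
    by (meson obtain_subset_with_card_n)
  have "finite B"
    using B(1) finite_nbs[OF assms] by (rule finite_subset)
  then obtain g where g: "bij_betw g {1..k} B"
    using B(2) by (metis card_atLeastAtMost diff_Suc_1 finite_atLeastAtMost finite_same_card_bij)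
  define f where "f = g(0 := v)"
  have im: "g i \<in> nbs G v" if "1 \<le> i" "i \<le> k" for i
    using that bij_betw_apply[OF g, of i] B(1) by auto
  have im': "g i \<in> pverts G" "g i \<noteq> v" if "1 \<le> i" "i \<le> k" for i
    using im[OF that] nbs_subset[OF assms] by auto
  have "inj_on f {1..k}"
    using g by (auto simp: f_def bij_betw_def intro: inj_on_cong[THEN iffD1])
  moreover have "f 0 \<notin> f ` {1..k}"
    using im'(2) by (force simp: f_def)
  moreover have "{0..k} = insert 0 {1..k}" by auto
  ultimately have "inj_on f {0..k}" by (simp add: inj_on_insert)
  moreover have "f ` {0..k} \<subseteq> pverts G"
    using v im' by (auto simp: f_def Suc_le_eq)
  moreover have "(f a, f b) \<in> parcs G" if "(a, b) \<in> parcs (star k)" for a b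
  proof -
    have "f b \<in> nbs G (f a) \<or> f a \<in> nbs G (f b)"
      using that im by (auto simp: star_def simple_graph_def f_def)
    then show ?thesis using nbs_sym[OF assms] by (auto simp: nbs_def)
  qed
  ultimately show "contains_copy G (star k)"
    unfolding contains_copy_iff[OF assms pair_graph_star]
    by (intro exI[of _ f]) (auto simp: star_def simple_graph_def)
qed

text \<open>The image of \<open>V 0\<close> keeps both its leaves and the other centre
  \<open>W 0\<close> as neighbours. This degree condition is the only obstruction to a double star
  that the lower bound uses.\<close>

lemma contains_double_star_imp_degree:
  assumes "pair_graph G" "contains_copy G (double_star n\<^sub>1 n\<^sub>2)"
  shows "\<exists>v\<in>pverts G. n\<^sub>1 + 1 \<le> card (nbs G v)"
proof -
  obtain f where f: "inj_on f (pverts (double_star n\<^sub>1 n\<^sub>2))"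
    "f ` pverts (double_star n\<^sub>1 n\<^sub>2) \<subseteq> pverts G"
    "\<forall>(u, v) \<in> parcs (double_star n\<^sub>1 n\<^sub>2). (f u, f v) \<in> parcs G"
    using assms(2) unfolding contains_copy_iff[OF assms(1) pair_graph_double_star] by blast
  let ?S = "insert (W 0) (V ` {1..n\<^sub>1})"
  have "f ` ?S \<subseteq> nbs G (f (V 0))"
    using f(3) by (auto simp: nbs_def double_star_def simple_graph_def)
  then have "card (f ` ?S) \<le> card (nbs G (f (V 0)))"
    by (intro card_mono finite_nbs assms)
  moreover have "card (f ` ?S) = card ?S"
    by (intro card_image inj_on_subset[OF f(1)]) (auto simp: double_star_def simple_graph_def)
  moreover have "card ?S = n\<^sub>1 + 1"
    by (subst card_insert_disjoint) (auto simp: card_image inj_on_def)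
  moreover have "f (V 0) \<in> pverts G"
    using f(2) by (auto simp: double_star_def simple_graph_def)
  ultimately show ?thesis by auto
qed

text \<open>A two-set case of Hall's theorem with multiplicities. Elements of \<open>A - B\<close>
  cost \<open>B\<close> nothing, so \<open>A'\<close> takes those first and borrows a set
  \<open>C\<close> from the intersection only for the shortfall. The bound on the union then leaves
  at least \<open>b\<close> elements in \<open>B - C\<close>.\<close>

lemma disjoint_representatives:
  assumes "finite A" "finite B" "a \<le> card A" "b \<le> card B" "a + b \<le> card (A \<union> B)"
  obtains A' B' where "A' \<subseteq> A" "B' \<subseteq> B" "A' \<inter> B' = {}" "card A' = a" "card B' = b"
proof (cases "a \<le> card (A - B)")
  case True
  then obtain A' where "A' \<subseteq> A - B" "card A' = a" by (meson obtain_subset_with_card_n)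
  moreover obtain B' where "B' \<subseteq> B" "card B' = b"
    using assms(4) by (meson obtain_subset_with_card_n)
  ultimately show ?thesis using that[of A' B'] by blast
next
  case False
  have "card A = card (A - B) + card (A \<inter> B)"
    using assms(1) by (metis add.commute card_Int_Diff)
  then have "a - card (A - B) \<le> card (A \<inter> B)" using assms(3) by simp
  then obtain C where C: "C \<subseteq> A \<inter> B" "card C = a - card (A - B)"
    by (meson obtain_subset_with_card_n)
  have finC: "finite C" using C(1) assms(1) by (meson finite_Int finite_subset)
  have U: "card (A \<union> B) = card (A - B) + card B"
    using assms(1,2) by (subst card_Un_disjoint[symmetric]) (auto intro: arg_cong[of _ _ card])
  have "card (B - C) = card B - card C"
    using C(1) finC by (intro card_Diff_subset) auto
  then have "b \<le> card (B - C)" using U C(2) assms(5) False by simp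
  then obtain B' where B': "B' \<subseteq> B - C" "card B' = b" by (meson obtain_subset_with_card_n)
  have "card ((A - B) \<union> C) = card (A - B) + card C"
    using assms(1) finC C(1) by (intro card_Un_disjoint) auto
  then have "card ((A - B) \<union> C) = a" using C(2) False by simp
  then show ?thesis using that[of "(A - B) \<union> C" B'] B' C(1) by blast
qed

text \<open>With adjacent centres \<open>v\<close> and \<open>w\<close> fixed, only disjoint sets of
  leaves remain to be chosen. The three inequalities are exactly what
  \<open>disjoint_representatives\<close> needs.\<close>

lemma contains_double_starI:
  assumes G: "pair_graph G" and w: "w \<in> nbs G v"
    and "n\<^sub>1 \<le> card (nbs G v - {w})" "n\<^sub>2 \<le> card (nbs G w - {v})"
    and "n\<^sub>1 + n\<^sub>2 \<le> card (nbs G v \<union> nbs G w - {v, w})"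
  shows "contains_copy G (double_star n\<^sub>1 n\<^sub>2)"
proof -
  have "nbs G v \<union> nbs G w - {v, w} = (nbs G v - {w}) \<union> (nbs G w - {v})"
    using nbs_subset[OF G] by blast
  then obtain A B where A: "A \<subseteq> nbs G v - {w}" "card A = n\<^sub>1"
    and B: "B \<subseteq> nbs G w - {v}" "card B = n\<^sub>2" and AB: "A \<inter> B = {}"
    using disjoint_representatives[of "nbs G v - {w}" "nbs G w - {v}" n\<^sub>1 n\<^sub>2]
      assms finite_nbs[OF G] by (metis finite_Diff)
  have "finite A" "finite B"
    using A(1) B(1) finite_nbs[OF G] by (meson finite_Diff finite_subset)+
  then obtain g h where g: "bij_betw g {1..n\<^sub>1} A" and h: "bij_betw h {1..n\<^sub>2} B"
    using A(2) B(2)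
    by (metis card_atLeastAtMost diff_Suc_1 finite_atLeastAtMost finite_same_card_bij)
  define f where "f x = (case x of V i \<Rightarrow> if i = 0 then v else g i
    | W j \<Rightarrow> if j = 0 then w else h j)" for x
  have gA: "g i \<in> A" if "i \<noteq> 0" "i \<le> n\<^sub>1" for i
    using that by (intro bij_betw_apply[OF g]) auto
  have hB: "h i \<in> B" if "i \<noteq> 0" "i \<le> n\<^sub>2" for i
    using that by (intro bij_betw_apply[OF h]) auto
  have ginj: "i = j" if "g i = g j" "i \<noteq> 0" "i \<le> n\<^sub>1" "j \<noteq> 0" "j \<le> n\<^sub>1" for i j
    using that by (intro inj_onD[OF bij_betw_imp_inj_on[OF g]]) auto
  have hinj: "i = j" if "h i = h j" "i \<noteq> 0" "i \<le> n\<^sub>2" "j \<noteq> 0" "j \<le> n\<^sub>2" for i j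
    using that by (intro inj_onD[OF bij_betw_imp_inj_on[OF h]]) auto
  have vA: "v \<notin> A" "w \<notin> A" "v \<notin> B" "w \<notin> B" "v \<noteq> w"
    using A(1) B(1) w nbs_subset[OF G] by blast+
  have fV: "f (V i) = (if i = 0 then v else g i)" and fW: "f (W i) = (if i = 0 then w else h i)" for i
    by (simp_all add: f_def)
  let ?P = "V ` {0..n\<^sub>1} \<union> W ` {0..n\<^sub>2}"
  have "inj_on f ?P"
  proof (rule inj_onI)
    fix x y assume *: "x \<in> ?P" "y \<in> ?P" "f x = f y"
    have VW: False if "f (V i) = f (W j)" "i \<le> n\<^sub>1" "j \<le> n\<^sub>2" for i j
      using that gA[of i] hB[of j] vA AB by (auto simp: fV fW split: if_splits)
    have VV: "i = j" if "f (V i) = f (V j)" "i \<le> n\<^sub>1" "j \<le> n\<^sub>1" for i j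
      using that gA[of i] gA[of j] vA ginj[of i j] by (auto simp: fV split: if_splits)
    have WW: "i = j" if "f (W i) = f (W j)" "i \<le> n\<^sub>2" "j \<le> n\<^sub>2" for i j
      using that hB[of i] hB[of j] vA hinj[of i j] by (auto simp: fW split: if_splits)
    show "x = y"
    proof (cases x; cases y)
      fix i j assume "x = V i" "y = V j" then show ?thesis using * VV[of i j] by auto
    next
      fix i j assume "x = V i" "y = W j" then show ?thesis using * VW[of i j] by auto
    next
      fix i j assume "x = W i" "y = V j"
      then show ?thesis using * VW[of j i] by auto
    next
      fix i j assume "x = W i" "y = W j" then show ?thesis using * WW[of i j] by auto
    qed
  qed
  moreover have "f ` ?P \<subseteq> pverts G"
  proof -
    have "A \<subseteq> pverts G" "B \<subseteq> pverts G" "v \<in> pverts G" "w \<in> pverts G"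
      using A(1) B(1) w nbs_subset[OF G] nbs_in_pverts[OF G w] by blast+
    moreover have "f ` ?P \<subseteq> {v, w} \<union> A \<union> B"
      using gA hB by (auto simp: fV fW)
    ultimately show ?thesis by blast
  qed
  moreover define E where
    "E = {(V 0, V i) |i. i \<in> {1..n\<^sub>1}} \<union> {(V 0, W 0)} \<union> {(W 0, W j) |j. j \<in> {1..n\<^sub>2}}"
  have "(f a, f b) \<in> parcs G \<and> (f b, f a) \<in> parcs G" if "(a, b) \<in> E" for a b
  proof -
    have "g i \<in> nbs G v" if "i \<noteq> 0" "i \<le> n\<^sub>1" for i using gA[OF that] A(1) by blast
    moreover have "h i \<in> nbs G w" if "i \<noteq> 0" "i \<le> n\<^sub>2" for i using hB[OF that] B(1) by blast
    ultimately have "f b \<in> nbs G (f a)"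
      using that w by (auto simp: E_def fV fW)
    then show ?thesis using nbs_sym[OF G] by (auto simp: nbs_def)
  qed
  then have "\<forall>(a, b) \<in> E \<union> E\<inverse>. (f a, f b) \<in> parcs G" by auto
  moreover have "pverts (double_star n\<^sub>1 n\<^sub>2) = ?P" "parcs (double_star n\<^sub>1 n\<^sub>2) = E \<union> E\<inverse>"
    by (simp_all add: double_star_def simple_graph_def E_def)
  ultimately show ?thesis
    unfolding contains_copy_iff[OF G pair_graph_double_star] by metis
qed

section \<open>The handshake lemma\<close>

text \<open>The degree sum counts arcs. The linear order on vertices splits them into increasing and
  decreasing ones, and reversal matches the two halves.\<close>

lemma even_sum_card_nbs:
  fixes G :: "'a :: linorder pair_pre_digraph"
  assumes G: "pair_graph G"
  shows "even (\<Sum>v\<in>pverts G. card (nbs G v))"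
proof -
  interpret pair_graph G by fact
  let ?L = "{e \<in> parcs G. fst e < snd e}" and ?R = "{e \<in> parcs G. snd e < fst e}"
  have "(\<Sum>v\<in>pverts G. card (nbs G v)) = card (Sigma (pverts G) (nbs G))"
    using finite_pverts[OF G] finite_nbs[OF G] by simp
  also have "Sigma (pverts G) (nbs G) = ?L \<union> ?R"
    using in_arcsD1 no_loops by (fastforce simp: nbs_def)
  also have "card \<dots> = card ?L + card ?R"
    by (rule card_Un_disjoint) auto
  also have "?R = prod.swap ` ?L"
    using arcs_symmetric by (force simp: image_iff)
  also have "card \<dots> = card ?L"
    by (rule card_image) simp
  finally show ?thesis by simp
qed

section \<open>Circulant graphs and their induced subgraphs\<close>

text \<open>The circulant graph on the residues modulo \<open>M\<close> that joins \<open>x\<close>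
  to x + j and x - j for 1 \<le> j \<le> h. The negative shifts are represented by
  \<open>{M - h..<M}\<close>, and \<open>2 * h < M\<close> keeps the two ranges of shifts
  disjoint.\<close>

lemma exists_even_regular_graph:
  assumes "2 * h < M"
  obtains G :: "nat pair_pre_digraph" where "pair_graph G" "pverts G = {..<M}"
    "\<And>v. v < M \<Longrightarrow> card (nbs G v) = 2 * h"
proof -
  let ?J = "{1..h} \<union> {M - h..<M}"
  define G where "G = \<lparr> pverts = {..<M},
    parcs = {(x, y). x < M \<and> y \<in> (\<lambda>j. (x + j) mod M) ` ?J} \<rparr>"
  have inj: "inj_on (\<lambda>j. (x + j) mod M) {..<M}" if "x < M" for x
  proof (rule inj_onI)
    fix i j assume ij: "i \<in> {..<M}" "j \<in> {..<M}" "(x + i) mod M = (x + j) mod M"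
    \<comment> \<open>Integers allow \<open>x\<close> to be subtracted from both sides of the
      congruence.\<close>
    then have "(int x + int i) mod int M = (int x + int j) mod int M"
      by (metis of_nat_add zmod_int)
    then have "int i mod int M = int j mod int M"
      by (metis add_diff_cancel_left' mod_diff_left_eq)
    then show "i = j" using ij by simp
  qed
  have J: "?J \<subseteq> {..<M}" "0 \<notin> ?J" using assms by auto
  have arc: "(x, y) \<in> parcs G \<longleftrightarrow> x < M \<and> (\<exists>j\<in>?J. y = (x + j) mod M)" for x y
    by (auto simp: G_def)
  have nb: "nbs G x = (\<lambda>j. (x + j) mod M) ` ?J" if "x < M" for x
    using that by (auto simp: nbs_def G_def)
  have "card (nbs G x) = 2 * h" if "x < M" for x
  proof -
    have "card (nbs G x) = card ?J"
      unfolding nb[OF that] by (intro card_image inj_on_subset[OF inj[OF that] J(1)])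
    also have "\<dots> = card {1..h} + card {M - h..<M}"
      using assms by (intro card_Un_disjoint) auto
    finally show ?thesis using assms by simp
  qed
  moreover have "pair_graph G"
  proof -
    have sub: "parcs G \<subseteq> {..<M} \<times> {..<M}"
      using assms by (auto simp: G_def)
    have loops: "(x, x) \<notin> parcs G" for x
    proof
      assume "(x, x) \<in> parcs G"
      then obtain j where j: "x < M" "j \<in> ?J" "x = (x + j) mod M" unfolding arc by blast
      then have "(x + 0) mod M = (x + j) mod M" by simp
      then have "0 = j" using inj_onD[OF inj[OF j(1)], of 0 j] j J(1) by auto
      then show False using j J(2) by blast
    qed
    have symm: "(y, x) \<in> parcs G" if "(x, y) \<in> parcs G" for x y
    proof -
      obtain j where j: "x < M" "j \<in> ?J" "y = (x + j) mod M"
        using \<open>(x, y) \<in> parcs G\<close> unfolding arc by blast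
      \<comment> \<open>The shift by \<open>M - j\<close> undoes the shift by \<open>j\<close>, and
        \<open>?J\<close> is closed under this inversion.\<close>
      have "(y + (M - j)) mod M = (x + j + (M - j)) mod M"
        unfolding j(3) by (rule mod_add_left_eq)
      also have "\<dots> = x" using j(1,2) assms by auto
      finally have "x = (y + (M - j)) mod M" by simp
      moreover have "M - j \<in> ?J" using j(2) assms by auto
      moreover have "y < M" using j(1,3) by simp
      ultimately show ?thesis unfolding arc by blast
    qed
    have "finite (parcs G)" using sub by (rule finite_subset) simp
    moreover have "pverts G = {..<M}" by (simp add: G_def)
    ultimately show ?thesis
      using sub loops by unfold_locales (auto simp: symmetric_def intro: symI symm)
  qed
  ultimately show ?thesis using that by (simp add: G_def)
qed

text \<open>Passing to an induced subgraph increases no degree in the graph or in its complement.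
  All \<open>N \<le> M\<close> are covered because the Ramsey number is a least element: every
  smaller order has to be refuted.\<close>

lemma exists_graph_bounded_degrees:
  assumes "2 * h < M" "N \<le> M"
  obtains G :: "nat pair_pre_digraph" where "pair_graph G" "card (pverts G) = N"
    "\<And>v. v \<in> pverts G \<Longrightarrow> card (nbs G v) \<le> 2 * h"
    "\<And>v. v \<in> pverts G \<Longrightarrow> card (nbs (graph_complement G) v) \<le> M - 1 - 2 * h"
proof -
  obtain G :: "nat pair_pre_digraph" where G: "pair_graph G" "pverts G = {..<M}"
    "\<And>v. v < M \<Longrightarrow> card (nbs G v) = 2 * h"
    using exists_even_regular_graph[OF assms(1)] by blast
  interpret pair_graph G by fact
  define H where "H = \<lparr> pverts = {..<N}, parcs = parcs G \<inter> {..<N} \<times> {..<N} \<rparr>"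
  have "finite (parcs H)" by (simp add: H_def)
  then have "pair_graph H"
    using no_loops arcs_symmetric
    by unfold_locales (auto simp: H_def symmetric_def intro!: symI)
  moreover have "card (nbs H v) \<le> 2 * h" if "v \<in> pverts H" for v
  proof -
    have "v < M" using that assms(2) by (simp add: H_def)
    then show ?thesis
      using card_mono[OF finite_nbs[OF G(1)], of "nbs H v" v] G(3)[of v] by (auto simp: nbs_def H_def)
  qed
  moreover have "card (nbs (graph_complement H) v) \<le> M - 1 - 2 * h" if "v \<in> pverts H" for v
  proof -
    have v: "v < M" using that assms(2) by (simp add: H_def)
    have "card (nbs (graph_complement H) v) \<le> card (nbs (graph_complement G) v)"
    proof (rule card_mono)
      show "finite (nbs (graph_complement G) v)"
        by (intro finite_nbs pair_graph_complement G(1))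
      have "nbs H v = nbs G v \<inter> {..<N}" using that by (auto simp: nbs_def H_def)
      moreover have "pverts H = {..<N}" by (simp add: H_def)
      ultimately show "nbs (graph_complement H) v \<subseteq> nbs (graph_complement G) v"
        using v that assms(2) G(2) by (auto simp: nbs_complement)
    qed
    then show ?thesis
      using card_nbs_complement[OF G(1), of v] G(2) G(3)[OF v] v by simp
  qed
  ultimately show ?thesis using that[of H] by (simp add: H_def)
qed

section \<open>Double counting the edges between two vertex sets\<close>

lemma sum_card_nbs_swap:
  assumes "pair_graph G" "finite A" "finite B"
  shows "(\<Sum>v\<in>A. card (nbs G v \<inter> B)) = (\<Sum>w\<in>B. card (nbs G w \<inter> A))"
proof -
  have "(\<Sum>v\<in>A. card {w \<in> B. w \<in> nbs G v}) = (\<Sum>w\<in>B. card {v \<in> A. w \<in> nbs G v})"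
    by (rule sum_multicount_gen) (use assms in auto)
  moreover have "{w \<in> B. w \<in> nbs G v} = nbs G v \<inter> B" for v by blast
  moreover have "{v \<in> A. w \<in> nbs G v} = nbs G w \<inter> A" for w
    using nbs_sym[OF assms(1)] by blast
  ultimately show ?thesis by simp
qed

text \<open>The right side minus the left is affine in \<open>e\<close> with positive slope
  \<open>2 * p - 1 - k\<close>, so \<open>e = 1\<close> is the worst case. There the claim is the
  first assumption.\<close>

lemma edge_count_bound:
  fixes p k n e :: int
  assumes "p\<^sup>2 - 3 * p + k + 1 < n * (p - k)" "1 \<le> e" "k < p" "1 \<le> p"
  shows "(n + e) * (k - e) < (p - e) * (n - p + 1 + e)"
proof -
  have "1 * (2 * p - 1 - k) \<le> e * (2 * p - 1 - k)"
    using assms by (intro mult_right_mono) auto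
  moreover have "(p - e) * (n - p + 1 + e) - (n + e) * (k - e)
      = n * (p - k) - p\<^sup>2 + p + e * (2 * p - 1 - k)"
    by (simp add: algebra_simps power2_eq_square)
  ultimately show ?thesis using assms(1) by simp
qed

text \<open>To be applied to the complement of a star-free graph, with \<open>p\<close> for m - 2
  and \<open>k\<close> for \<open>n\<^sub>2\<close>.\<close>

lemma contains_double_star_of_min_degree:
  fixes p k n :: nat
  assumes H: "pair_graph H" and N: "card (pverts H) = p + 1 + n"
    and min_deg: "\<And>u. u \<in> pverts H \<Longrightarrow> n \<le> card (nbs H u)"
    and v: "v \<in> pverts H" "n + 1 \<le> card (nbs H v)"
    and kp: "k < p" "p \<le> n"
    and bound: "(int p)\<^sup>2 - 3 * int p + int k + 1 < int n * (int p - int k)"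
  shows "contains_copy H (double_star n k)"
proof (rule ccontr)
  assume no: "\<not> contains_copy H (double_star n k)"
  \<comment> \<open>An integer, since \<open>k - e\<close> may be negative below.\<close>
  define e where "e = int (card (nbs H v)) - int n"
  have e: "e \<ge> 1" using v(2) by (simp add: e_def)
  let ?B = "nbs H v"
  define A where "A = pverts H - {v} - nbs H v"
  have fin: "finite A" "finite ?B" using finite_pverts[OF H] finite_nbs[OF H] by (auto simp: A_def)
  have "card ?B + card A + 1 = card (pverts H)"
    using card_nbs_complement[OF H v(1)] nbs_complement[OF v(1)] by (simp add: A_def)
  then have cardA: "int (card A) = int p - e" using N by (simp add: e_def)
  have outside: "int (card (nbs H w \<inter> A)) \<le> int k - e" if w: "w \<in> ?B" for w
  proof (rule ccontr)
    assume "\<not> ?thesis"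
    then have big: "int k - e + 1 \<le> int (card (nbs H w \<inter> A))" by simp
    have wV: "w \<in> pverts H" using w nbs_subset[OF H] by blast
    have vw: "v \<in> nbs H w" using w nbs_sym[OF H] by blast
    have cB: "card (?B - {w}) + 1 = card ?B"
      using w fin(2) by (metis Suc_eq_plus1 card_Suc_Diff1)
    have cw: "card (nbs H w - {v}) + 1 = card (nbs H w)"
      using vw finite_nbs[OF H] by (metis Suc_eq_plus1 card_Suc_Diff1)
    \<comment> \<open>The two parts have n + e - 1 and at least k - e + 1 elements, so
      \<open>e\<close> cancels and the union bound n + k for a double star is met.\<close>
    have "card ((?B - {w}) \<union> (nbs H w \<inter> A)) = card (?B - {w}) + card (nbs H w \<inter> A)"
      using fin by (intro card_Un_disjoint) (auto simp: A_def)
    moreover have "card ((?B - {w}) \<union> (nbs H w \<inter> A)) \<le> card (?B \<union> nbs H w - {v, w})"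
      using fin finite_nbs[OF H] nbs_subset[OF H] by (intro card_mono) (auto simp: A_def)
    moreover have "int (card ?B) = int n + e" by (simp add: e_def)
    ultimately have "n + k \<le> card (?B \<union> nbs H w - {v, w})" using cB big by linarith
    moreover have "n \<le> card (?B - {w})" using cB v(2) by simp
    \<comment> \<open>The degree of \<open>w\<close> is at least n \<ge> p > k, and only
      \<open>v\<close> is removed.\<close>
    moreover have "k \<le> card (nbs H w - {v})" using cw min_deg[OF wV] kp by simp
    ultimately show False using no contains_double_starI[OF H w] by blast
  qed
  have inside: "int n - int p + 1 + e \<le> int (card (nbs H a \<inter> ?B))" if a: "a \<in> A" for a
  proof -
    have aV: "a \<in> pverts H" using a by (simp add: A_def)
    have "v \<notin> nbs H a" using a nbs_sym[OF H] by (auto simp: A_def)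
    \<comment> \<open>At most |A| - 1 = p - e - 1 neighbours of \<open>a\<close> lie in
      \<open>A\<close>; the rest of its at least \<open>n\<close> neighbours must lie in
      \<open>?B\<close>.\<close>
    then have "nbs H a \<subseteq> (nbs H a \<inter> ?B) \<union> (A - {a})"
      using nbs_subset[OF H] by (fastforce simp: A_def)
    then have "card (nbs H a) \<le> card ((nbs H a \<inter> ?B) \<union> (A - {a}))"
      using fin by (intro card_mono) auto
    also have "\<dots> \<le> card (nbs H a \<inter> ?B) + card (A - {a})" by (rule card_Un_le)
    finally have "n \<le> card (nbs H a \<inter> ?B) + card (A - {a})" using min_deg[OF aV] by simp
    moreover have "card (A - {a}) + 1 = card A"
      using a fin(1) by (metis Suc_eq_plus1 card_Suc_Diff1)
    ultimately show ?thesis using cardA by linarith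
  qed
  have "(int p - e) * (int n - int p + 1 + e) \<le> (\<Sum>a\<in>A. int (card (nbs H a \<inter> ?B)))"
    using sum_bounded_below[of A "int n - int p + 1 + e"] inside cardA by simp
  also have "\<dots> = (\<Sum>w\<in>?B. int (card (nbs H w \<inter> A)))"
    using sum_card_nbs_swap[OF H fin] by (metis of_nat_sum)
  also have "\<dots> \<le> (int n + e) * (int k - e)"
    using sum_bounded_above[of ?B "\<lambda>w. int (card (nbs H w \<inter> A))" "int k - e"] outside
    by (simp add: e_def)
  finally show False
    using edge_count_bound[OF bound e] kp by simp
qed

section \<open>The Ramsey number as the least order, from both bounds\<close>

theorem theorem4p2:
  fixes m n\<^sub>1 n\<^sub>2 :: nat
  assumes "m > 0" and "n\<^sub>1 > 0" and "n\<^sub>2 > 0"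
    and "int n\<^sub>1 \<ge> int m - 2" and "int m - 2 > int n\<^sub>2"
    and "\<not> 2 dvd m * n\<^sub>1"
    and "real n\<^sub>1 > real m - 5 + real n\<^sub>2 + (real n\<^sub>2 - 1)\<^sup>2 / (real m - 2 - real n\<^sub>2)"
  shows "ramsey_number (star (m - 1)) (double_star n\<^sub>1 n\<^sub>2) = m - 1 + n\<^sub>1"
proof -
  define p where "p = m - 2"
  have m: "m = p + 2" and p: "n\<^sub>2 < p" "p \<le> n\<^sub>1" using assms(4,5) by (auto simp: p_def)
  have odd: "odd p" "odd n\<^sub>1" using assms(6) m by auto
  \<comment> \<open>The hypothesis on \<open>n\<^sub>1\<close>, cleared of its denominator and moved
    to the integers.\<close>
  have bound: "(int p)\<^sup>2 - 3 * int p + int n\<^sub>2 + 1 < int n\<^sub>1 * (int p - int n\<^sub>2)"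
  proof -
    have pos: "real p - real n\<^sub>2 > 0" using p by simp
    have "(real n\<^sub>2 - 1)\<^sup>2 / (real p - real n\<^sub>2) < real n\<^sub>1 - real p + 3 - real n\<^sub>2"
      using assms(7) m by (simp add: algebra_simps)
    then have "(real n\<^sub>2 - 1)\<^sup>2 < (real n\<^sub>1 - real p + 3 - real n\<^sub>2) * (real p - real n\<^sub>2)"
      using pos by (simp add: pos_divide_less_eq)
    then have "(real p)\<^sup>2 - 3 * real p + real n\<^sub>2 + 1 < real n\<^sub>1 * (real p - real n\<^sub>2)"
      by (simp add: algebra_simps power2_eq_square)
    then have "real_of_int ((int p)\<^sup>2 - 3 * int p + int n\<^sub>2 + 1)
        < real_of_int (int n\<^sub>1 * (int p - int n\<^sub>2))" by simp
    then show ?thesis by linarith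
  qed
  have upper: "contains_copy (graph_complement G) (double_star n\<^sub>1 n\<^sub>2)"
    if G: "pair_graph G" and N: "card (pverts G) = p + 1 + n\<^sub>1"
      and no_star: "\<not> contains_copy G (star (p + 1))" for G :: "nat pair_pre_digraph"
  proof -
    have deg: "card (nbs G u) \<le> p" if "u \<in> pverts G" for u
      using that no_star contains_star_iff[OF G, of "p + 1"] by force
    \<comment> \<open>Otherwise an odd number p + 1 + \<open>n\<^sub>1\<close> of vertices would all
      have the odd degree \<open>p\<close>, against the handshake lemma.\<close>
    have "\<exists>v\<in>pverts G. card (nbs G v) \<noteq> p"
    proof (rule ccontr)
      assume "\<not> ?thesis"
      then have "(\<Sum>v\<in>pverts G. card (nbs G v)) = (p + 1 + n\<^sub>1) * p" using N by simp
      then show False using even_sum_card_nbs[OF G] odd by simp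
    qed
    then obtain v where v: "v \<in> pverts G" "card (nbs G v) < p"
      using deg le_neq_implies_less by blast
    show "contains_copy (graph_complement G) (double_star n\<^sub>1 n\<^sub>2)"
    proof (rule contains_double_star_of_min_degree[OF pair_graph_complement[OF G] _ _ _ _ p bound])
      show "n\<^sub>1 \<le> card (nbs (graph_complement G) u)" if "u \<in> pverts (graph_complement G)" for u
        using that card_nbs_complement[OF G, of u] deg[of u] N by simp
      show "n\<^sub>1 + 1 \<le> card (nbs (graph_complement G) v)"
        using card_nbs_complement[OF G v(1)] v(2) N by simp
    qed (use v N in auto)
  qed
  have lower: "p + 1 + n\<^sub>1 \<le> N"
    if N: "\<forall>G :: nat pair_pre_digraph. pair_graph G \<and> card (pverts G) = N \<longrightarrow>
        contains_copy G (star (p + 1)) \<or>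
        contains_copy (graph_complement G) (double_star n\<^sub>1 n\<^sub>2)" for N
  proof (rule ccontr)
    assume "\<not> ?thesis"
    then have Np: "N \<le> p + n\<^sub>1" by simp
    \<comment> \<open>The circulant graph on p + \<open>n\<^sub>1\<close> vertices has degree 2h = p
      - 1, one too few for the star; its complement has degree \<open>n\<^sub>1\<close>, one too few
      for \<open>V 0\<close>.\<close>
    obtain h where h: "p = 2 * h + 1" using odd(1) by (auto elim: oddE)
    then have hp: "2 * h < p + n\<^sub>1" by simp
    obtain G :: "nat pair_pre_digraph" where G: "pair_graph G" "card (pverts G) = N"
      "\<And>v. v \<in> pverts G \<Longrightarrow> card (nbs G v) \<le> 2 * h"
      "\<And>v. v \<in> pverts G \<Longrightarrow> card (nbs (graph_complement G) v) \<le> p + n\<^sub>1 - 1 - 2 * h"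
      by (rule exists_graph_bounded_degrees[OF hp Np]) (rule that)
    consider "contains_copy G (star (p + 1))" |
      "contains_copy (graph_complement G) (double_star n\<^sub>1 n\<^sub>2)"
      using N G(1,2) by blast
    then show False
    proof cases
      case 1
      then obtain v where "v \<in> pverts G" "p + 1 \<le> card (nbs G v)"
        unfolding contains_star_iff[OF G(1)] by blast
      then show False using G(3)[of v] h by simp
    next
      case 2
      then obtain v where "v \<in> pverts G" "n\<^sub>1 + 1 \<le> card (nbs (graph_complement G) v)"
        using contains_double_star_imp_degree[OF pair_graph_complement[OF G(1)]] by auto
      then show False using G(4)[of v] h by simp
    qed
  qed
  have "ramsey_number (star (p + 1)) (double_star n\<^sub>1 n\<^sub>2) = p + 1 + n\<^sub>1"
    unfolding ramsey_number_def
    using upper lower by (intro Least_equality) auto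
  then show ?thesis using m by simp
qed

end
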